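(* Let $d=2^{n+1}$ be the dimension of an $(n+1)$-qubit system, let $r\in(0,1]$ be a known constant, and let $A$ be a unitary operator with $A|0\rangle_{n+1}=\cos\theta|\psi_0\rangle_n|0\rangle+\sin\theta|\psi_1\rangle_n|1\rangle$, where $|\psi_0\rangle_n,|\psi_1\rangle_n$ are normalized $n$-qubit states and $\theta$ is an unknown parameter. For $X\in\{G,Q\}$ let $$\rho_{X,r}(\theta,N_{\mathrm q})=r^{N_{\mathrm q}}|\psi_X(\theta,N_{\mathrm q})\rangle\langle\psi_X(\theta,N_{\mathrm q})|+(1-r^{N_{\mathrm q}})\frac{\mathbf{I}_{n+1}}{d},$$ $$|\psi_G(\theta,N_{\mathrm q})\rangle=\cos(N_{\mathrm q}\theta)|\psi_0\rangle_n|0\rangle+\sin(N_{\mathrm q}\theta)|\psi_1\rangle_n|1\rangle,\qquad |\psi_Q(\theta,N_{\mathrm q})\rangle=\cos(N_{\mathrm q}\theta)|0\rangle_{n+1}+\sin(N_{\mathrm q}\theta)|\phi\rangle_{n+1},$$ with $|\phi\rangle_{n+1}=A^\dagger(-\sin\theta|\psi_0\rangle_n|0\rangle+\cos\theta|\psi_1\rangle_n|1\rangle)$. Let $F_{\mathrm q,X,r}(\theta,N_{\mathrm q})$ be the quantum Fisher information about $\theta$ of $\rho_{X,r}(\theta,N_{\mathrm q})$, and let $F_{\mathrm c,X,r}(\theta,N_{\mathrm q})$ be the classical Fisher information about $\theta$ of the outcome distribution obtained by measuring $\rho_{X,r}(\theta,N_{\mathrm q})$ with $\{E_{X,0},E_{X,1}\}$,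 where $E_{G,i}=\mathbf{I}_n\otimes|i\rangle\langle i|$ for $i\in\{0,1\}$, $E_{Q,0}=|0\rangle_{n+1}\langle0|_{n+1}$ and $E_{Q,1}=\mathbf{I}_{n+1}-E_{Q,0}$. Let $F_{\mathrm c,X,r}(N_{\mathrm q})|_{\mathrm{env}}$ be the $\theta$-independent upper envelope of $F_{\mathrm c,X,r}(\theta,N_{\mathrm q})$, i.e. its maximization with respect to $\theta$. Then: (i) $$F_{\mathrm c,G,r}(N_{\mathrm q})|_{\mathrm{env}}\le F_{\mathrm c,Q,r}(N_{\mathrm q})|_{\mathrm{env}}\le F_{\mathrm q,Q,r}(\theta,N_{\mathrm q})=F_{\mathrm q,G,r}(\theta,N_{\mathrm q});$$ (ii) equality in the first inequality holds only when $d=2$; moreover $F_{\mathrm c,Q,r}(N_{\mathrm q})|_{\mathrm{env}}=F_{\mathrm q,Q,r}(\theta,N_{\mathrm q})$ holds when $d=2$; (iii) $$\lim_{d\to\infty}\left\{F_{\mathrm c,Q,r}(N_{\mathrm q})|_{\mathrm{env}}-F_{\mathrm q,Q,r}(\theta,N_{\mathrm q})\right\}=0.$$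
   Context: $\mathbf{I}_k$ is the identity on $k$ qubits; $|0\rangle_{n+1}$ is the all-zero computational basis state. The classical Fisher information of a distribution $p(i;\theta)=\mathrm{Tr}(\rho(\theta)E_i)$, $i\in\{0,1\}$, is $\sum_i\left(\partial_\theta\ln p(i;\theta)\right)^2p(i;\theta)$. The quantum Fisher information of a family of states $\rho(\theta)$ is $\mathrm{Tr}(\rho(\theta)L^2)$, where $L$ is the symmetric logarithmic derivative, i.e. the Hermitian operator with $\partial_\theta\rho=\frac12(\rho L+L\rho)$. The explicit values are $$F_{\mathrm c,G,r}(N_{\mathrm q})|_{\mathrm{env}}=4N_{\mathrm q}^2r^{2N_{\mathrm q}},$$ $$F_{\mathrm c,Q,r}(N_{\mathrm q})|_{\mathrm{env}}=4N_{\mathrm q}^2r^{N_{\mathrm q}}+8N_{\mathrm q}^2\frac{d-1}{d^2}(1-r^{N_{\mathrm q}})^2-\frac{8N_{\mathrm q}^2(1-r^{N_{\mathrm q}})\sqrt{(d-1)(d-1+r^{N_{\mathrm q}})((d-1)r^{N_{\mathrm q}}+1)}}{d^2},$$ $$F_{\mathrm q,G,r}(\theta,N_{\mathrm q})=F_{\mathrm q,Q,r}(\theta,N_{\mathrm q})=\frac{4N_{\mathrm q}^2r^{2N_{\mathrm q}}}{\frac2d+\left(1-\frac2d\right)r^{N_{\mathrm q}}}.$$ Origin of the states: with $U_0=-\mathbf{I}_{n+1}+2|0\rangle_{n+1}\langle0|_{n+1}$, $U_f=-\mathbf{I}_{n+1}+2\mathbf{I}_n\otimes|0\rangle\langle0|$,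 $G=AU_0A^\dagger U_f$ and $Q=U_0A^\dagger U_fA$, the states $\rho_{G,r}(\theta,2m+1)$ and $\rho_{Q,r}(\theta,2m)$ result from $G^mA|0\rangle_{n+1}$ and $Q^m|0\rangle_{n+1}$ respectively when the depolarizing channel $\mathcal{D}(\rho)=r\rho+(1-r)\mathbf{I}_{n+1}/d$ acts at every use of $A$ or $A^\dagger$. The two methods are compared as if $N_{\mathrm q}$, the number of uses of $A$ and $A^\dagger$, took all integer values in each.
   Formalization: In (ii), "equality in the first inequality holds only when d=2" is stated for r<1 and N_q≥1, since for r=1 both envelopes are 4N_q² for every d and for N_q=0 both are 0; |φ⟩ is read as one fixed state independent of θ. *)

theory Defs
  imports "HOL-Analysis.Derivative" "Jordan_Normal_Form.Schur_Decomposition"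
begin

section \<open>Linear algebra on qubit spaces\<close>

text \<open>A state vector of \<open>k\<close> qubits is an element of \<open>carrier_vec (2 ^ k)\<close>. The last tensor
  factor is the least significant digit of an index, so that the basis state with first \<open>n\<close>
  qubits \<open>x\<close> and last qubit \<open>b\<close> is \<open>unit_vec (2 ^ (n + 1)) (2 * x + b)\<close>.\<close>

definition tensor_vec :: "complex vec \<Rightarrow> complex vec \<Rightarrow> complex vec" where
  "tensor_vec u v =
     vec (dim_vec u * dim_vec v) (\<lambda>i. u $ (i div dim_vec v) * v $ (i mod dim_vec v))"

definition tensor_mat :: "complex mat \<Rightarrow> complex mat \<Rightarrow> complex mat" where
  "tensor_mat M K =
     mat (dim_row M * dim_row K) (dim_col M * dim_col K)
       (\<lambda>(i, j). M $$ (i div dim_row K, j div dim_col K) * K $$ (i mod dim_row K, j mod dim_col K))"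

definition ketbra :: "complex vec \<Rightarrow> complex vec \<Rightarrow> complex mat" where
  "ketbra u v = mat (dim_vec u) (dim_vec v) (\<lambda>(i, j). u $ i * cnj (v $ j))"

definition mat_trace :: "complex mat \<Rightarrow> complex" where
  "mat_trace M = (\<Sum>i<dim_row M. M $$ (i, i))"

definition hermitian_mat :: "nat \<Rightarrow> complex mat \<Rightarrow> bool" where
  "hermitian_mat d L \<longleftrightarrow> L \<in> carrier_mat d d \<and> mat_adjoint L = L"

definition unitary_mat :: "nat \<Rightarrow> complex mat \<Rightarrow> bool" where
  "unitary_mat d U \<longleftrightarrow>
     U \<in> carrier_mat d d \<and> mat_adjoint U * U = 1\<^sub>m d \<and> U * mat_adjoint U = 1\<^sub>m d"

definition normalized_vec :: "nat \<Rightarrow> complex vec \<Rightarrow> bool" where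
  "normalized_vec d v \<longleftrightarrow> v \<in> carrier_vec d \<and> v \<bullet>c v = 1"

definition ket :: "nat \<Rightarrow> complex vec" where
  "ket b = unit_vec 2 b"

definition ket_zeros :: "nat \<Rightarrow> complex vec" where
  "ket_zeros k = unit_vec (2 ^ k) 0"


section \<open>Fisher information\<close>

text \<open>An outcome of probability \<open>0\<close> at \<open>\<theta>\<close> contributes \<open>0\<close>, whatever value \<open>deriv\<close> takes there.\<close>

definition classical_fisher :: "(nat \<Rightarrow> real \<Rightarrow> real) \<Rightarrow> real \<Rightarrow> real" where
  "classical_fisher p \<theta> = (\<Sum>i\<in>{0, 1}. (deriv (\<lambda>t. ln (p i t)) \<theta>)\<^sup>2 * p i \<theta>)"

definition outcome_prob :: "(real \<Rightarrow> complex mat) \<Rightarrow> (nat \<Rightarrow> complex mat) \<Rightarrow> nat \<Rightarrow> real \<Rightarrow> real" where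
  "outcome_prob \<rho> E i \<theta> = Re (mat_trace (\<rho> \<theta> * E i))"

text \<open>\<open>is_SLD d \<rho> \<theta> L\<close>: \<open>L\<close> is Hermitian and the entrywise derivative of \<open>\<rho>\<close> at \<open>\<theta>\<close> exists and
  is \<open>(\<rho> L + L \<rho>) / 2\<close>. If \<open>\<rho> \<theta>\<close> is singular, \<open>L\<close> is determined only up to a block on the
  kernel of \<open>\<rho> \<theta>\<close>, which does not affect the trace of \<open>\<rho> L\<^sup>2\<close>.\<close>

definition is_SLD :: "nat \<Rightarrow> (real \<Rightarrow> complex mat) \<Rightarrow> real \<Rightarrow> complex mat \<Rightarrow> bool" where
  "is_SLD d \<rho> \<theta> L \<longleftrightarrow>
     hermitian_mat d L \<and>
     (\<forall>i<d. \<forall>j<d. ((\<lambda>t. \<rho> t $$ (i, j)) has_vector_derivative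
        ((1 / 2) \<cdot>\<^sub>m (\<rho> \<theta> * L + L * \<rho> \<theta>)) $$ (i, j)) (at \<theta>))"

definition quantum_fisher :: "nat \<Rightarrow> (real \<Rightarrow> complex mat) \<Rightarrow> real \<Rightarrow> real" where
  "quantum_fisher d \<rho> \<theta> =
     (let L = (SOME L. is_SLD d \<rho> \<theta> L) in Re (mat_trace (\<rho> \<theta> * (L * L))))"


section \<open>Amplitude estimation with depolarizing noise\<close>

text \<open>\<open>A \<theta>\<close> is the amplitude-encoding unitary for the parameter value \<open>\<theta>\<close>. The vector \<open>\<phi>\<close> is one
  fixed state, so \<open>\<phi> = (A \<theta>)\<^sup>\<dagger> (- sin \<theta> \<psi>0 \<otimes> |0> + cos \<theta> \<psi>1 \<otimes> |1>)\<close> is required for every \<open>\<theta>\<close>: the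
  parameter enters the state \<open>psi_Q\<close> only through the displayed coefficients.\<close>

definition amplitude_setup ::
  "nat \<Rightarrow> (real \<Rightarrow> complex mat) \<Rightarrow> complex vec \<Rightarrow> complex vec \<Rightarrow> complex vec \<Rightarrow> bool" where
  "amplitude_setup n A \<psi>0 \<psi>1 \<phi> \<longleftrightarrow>
     normalized_vec (2 ^ n) \<psi>0 \<and> normalized_vec (2 ^ n) \<psi>1 \<and>
     (\<forall>\<theta>. unitary_mat (2 ^ (n + 1)) (A \<theta>) \<and>
        A \<theta> *\<^sub>v ket_zeros (n + 1) =
          complex_of_real (cos \<theta>) \<cdot>\<^sub>v tensor_vec \<psi>0 (ket 0)
          + complex_of_real (sin \<theta>) \<cdot>\<^sub>v tensor_vec \<psi>1 (ket 1) \<and>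
        \<phi> = mat_adjoint (A \<theta>) *\<^sub>v
          (complex_of_real (- sin \<theta>) \<cdot>\<^sub>v tensor_vec \<psi>0 (ket 0)
           + complex_of_real (cos \<theta>) \<cdot>\<^sub>v tensor_vec \<psi>1 (ket 1)))"

definition psi_G :: "complex vec \<Rightarrow> complex vec \<Rightarrow> nat \<Rightarrow> real \<Rightarrow> complex vec" where
  "psi_G \<psi>0 \<psi>1 N \<theta> =
     complex_of_real (cos (real N * \<theta>)) \<cdot>\<^sub>v tensor_vec \<psi>0 (ket 0)
     + complex_of_real (sin (real N * \<theta>)) \<cdot>\<^sub>v tensor_vec \<psi>1 (ket 1)"

definition psi_Q :: "nat \<Rightarrow> complex vec \<Rightarrow> nat \<Rightarrow> real \<Rightarrow> complex vec" where
  "psi_Q n \<phi> N \<theta> =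
     complex_of_real (cos (real N * \<theta>)) \<cdot>\<^sub>v ket_zeros (n + 1)
     + complex_of_real (sin (real N * \<theta>)) \<cdot>\<^sub>v \<phi>"

definition depolarized :: "nat \<Rightarrow> real \<Rightarrow> nat \<Rightarrow> complex vec \<Rightarrow> complex mat" where
  "depolarized d r N \<psi> =
     complex_of_real (r ^ N) \<cdot>\<^sub>m ketbra \<psi> \<psi>
     + complex_of_real ((1 - r ^ N) / real d) \<cdot>\<^sub>m 1\<^sub>m d"

definition rho_G :: "nat \<Rightarrow> real \<Rightarrow> complex vec \<Rightarrow> complex vec \<Rightarrow> nat \<Rightarrow> real \<Rightarrow> complex mat" where
  "rho_G n r \<psi>0 \<psi>1 N \<theta> = depolarized (2 ^ (n + 1)) r N (psi_G \<psi>0 \<psi>1 N \<theta>)"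

definition rho_Q :: "nat \<Rightarrow> real \<Rightarrow> complex vec \<Rightarrow> nat \<Rightarrow> real \<Rightarrow> complex mat" where
  "rho_Q n r \<phi> N \<theta> = depolarized (2 ^ (n + 1)) r N (psi_Q n \<phi> N \<theta>)"

definition E_G :: "nat \<Rightarrow> nat \<Rightarrow> complex mat" where
  "E_G n i = tensor_mat (1\<^sub>m (2 ^ n)) (ketbra (ket i) (ket i))"

definition E_Q :: "nat \<Rightarrow> nat \<Rightarrow> complex mat" where
  "E_Q n i = (let P = ketbra (ket_zeros (n + 1)) (ket_zeros (n + 1))
              in if i = 0 then P else 1\<^sub>m (2 ^ (n + 1)) - P)"

definition Fc_G :: "nat \<Rightarrow> real \<Rightarrow> complex vec \<Rightarrow> complex vec \<Rightarrow> nat \<Rightarrow> real \<Rightarrow> real" where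
  "Fc_G n r \<psi>0 \<psi>1 N = classical_fisher (outcome_prob (rho_G n r \<psi>0 \<psi>1 N) (E_G n))"

definition Fc_Q :: "nat \<Rightarrow> real \<Rightarrow> complex vec \<Rightarrow> nat \<Rightarrow> real \<Rightarrow> real" where
  "Fc_Q n r \<phi> N = classical_fisher (outcome_prob (rho_Q n r \<phi> N) (E_Q n))"

definition Fq_G :: "nat \<Rightarrow> real \<Rightarrow> complex vec \<Rightarrow> complex vec \<Rightarrow> nat \<Rightarrow> real \<Rightarrow> real" where
  "Fq_G n r \<psi>0 \<psi>1 N = quantum_fisher (2 ^ (n + 1)) (rho_G n r \<psi>0 \<psi>1 N)"

definition Fq_Q :: "nat \<Rightarrow> real \<Rightarrow> complex vec \<Rightarrow> nat \<Rightarrow> real \<Rightarrow> real" where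
  "Fq_Q n r \<phi> N = quantum_fisher (2 ^ (n + 1)) (rho_Q n r \<phi> N)"

definition envelope :: "(real \<Rightarrow> real) \<Rightarrow> real" where
  "envelope F = (SUP \<theta>. F \<theta>)"

end

theory Submission
  imports Defs "HOL-Real_Asymp.Real_Asymp"
begin

text \<open>Write \<open>q = r\<^sup>N\<close> and \<open>c = cos\<^sup>2 (N \<theta>)\<close>, \<open>s = 1 - c\<close>. Each measurement has outcome probabilities
  \<open>a + q c\<close> and \<open>b + q s\<close> with \<open>a + b + q = 1\<close>, so its Fisher information is
  \<open>4 N\<^sup>2 q\<^sup>2 c s / ((a + q c) (b + q s))\<close>; here \<open>a = b = (1 - q) / 2\<close> for \<open>G\<close>, and \<open>a = (1 - q) / d\<close>,
  \<open>b = (d - 1) a\<close> for \<open>Q\<close>. If \<open>a \<le> b\<close>, this is at most \<open>4 N\<^sup>2 q\<^sup>2 / (2 a + q)\<close>, the quantum Fisher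
  information when \<open>a = (1 - q) / d\<close>, and at \<open>c = 1 / 2\<close> it is at least \<open>4 N\<^sup>2 q\<^sup>2\<close>, the envelope for
  \<open>G\<close>. For the limit, evaluate at a \<open>c\<close> that tends to \<open>0\<close> more slowly than \<open>a\<close>, such as
  \<open>c = 1 / (n + 2)\<close>. So the closed form of the envelope for \<open>Q\<close> is not needed.\<close>

unbundle no vec_syntax

section \<open>Operators of rank one\<close>

lemma ketbra_carrier [simp]: "u \<in> carrier_vec d \<Longrightarrow> v \<in> carrier_vec e \<Longrightarrow> ketbra u v \<in> carrier_mat d e"
  by (auto simp: ketbra_def)

lemma cscalar_prod_sum:
  fixes u v :: "complex vec"
  assumes "u \<in> carrier_vec d" "v \<in> carrier_vec d"
  shows "u \<bullet>c v = (\<Sum>i<d. u $ i * cnj (v $ i))"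
  using assms by (auto simp: scalar_prod_def atLeast0LessThan)

lemma cscalar_prod_commute:
  fixes u v :: "complex vec"
  assumes "u \<in> carrier_vec d" "v \<in> carrier_vec d"
  shows "u \<bullet>c v = cnj (v \<bullet>c u)"
  using assms by (simp add: cscalar_prod_sum mult.commute)

lemma mat_mult_index:
  assumes "A \<in> carrier_mat d e" "B \<in> carrier_mat e f" "i < d" "j < f"
  shows "(A * B) $$ (i, j) = (\<Sum>k<e. A $$ (i, k) * B $$ (k, j))"
  using assms by (auto simp: scalar_prod_def atLeast0LessThan)

text \<open>The scalar is the bracket of \<open>v\<close> with \<open>w\<close>, since both
  \<open>\<bullet>c\<close> and \<open>ketbra\<close> conjugate their second argument.\<close>

lemma ketbra_mult:
  assumes "u \<in> carrier_vec d" "v \<in> carrier_vec d" "w \<in> carrier_vec d" "z \<in> carrier_vec d"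
  shows "ketbra u v * ketbra w z = (w \<bullet>c v) \<cdot>\<^sub>m ketbra u z"
proof (rule eq_matI)
  fix i j assume "i < dim_row ((w \<bullet>c v) \<cdot>\<^sub>m ketbra u z)" "j < dim_col ((w \<bullet>c v) \<cdot>\<^sub>m ketbra u z)"
  then have ij: "i < d" "j < d" using assms by (auto simp: ketbra_def)
  show "(ketbra u v * ketbra w z) $$ (i, j) = ((w \<bullet>c v) \<cdot>\<^sub>m ketbra u z) $$ (i, j)"
    using assms ij
    by (subst mat_mult_index[where d=d and e=d and f=d])
       (auto simp: cscalar_prod_sum ketbra_def sum_distrib_left sum_distrib_right mult_ac)
qed (use assms in \<open>auto simp: ketbra_def\<close>)

section \<open>Traces and adjoints\<close>

lemma mat_trace_ketbra:
  assumes "u \<in> carrier_vec d" "v \<in> carrier_vec d"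
  shows "mat_trace (ketbra u v) = u \<bullet>c v"
  using assms by (auto simp: mat_trace_def ketbra_def cscalar_prod_sum)

lemma mat_trace_add:
  "A \<in> carrier_mat d d \<Longrightarrow> B \<in> carrier_mat d d \<Longrightarrow> mat_trace (A + B) = mat_trace A + mat_trace B"
  by (auto simp: mat_trace_def sum.distrib)

lemma mat_trace_minus:
  "A \<in> carrier_mat d d \<Longrightarrow> B \<in> carrier_mat d d \<Longrightarrow> mat_trace (A - B) = mat_trace A - mat_trace B"
  by (auto simp: mat_trace_def sum_subtractf)

lemma mat_trace_smult: "A \<in> carrier_mat d d \<Longrightarrow> mat_trace (c \<cdot>\<^sub>m A) = c * mat_trace A"
  by (auto simp: mat_trace_def sum_distrib_left)

lemma mat_trace_one: "mat_trace (1\<^sub>m d) = of_nat d"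
  by (auto simp: mat_trace_def)

lemma mat_trace_mult_commute:
  assumes "A \<in> carrier_mat d d" "B \<in> carrier_mat d d"
  shows "mat_trace (A * B) = mat_trace (B * A)"
proof -
  have *: "mat_trace (X * Y) = (\<Sum>i<d. \<Sum>k<d. X $$ (i, k) * Y $$ (k, i))"
    if "X \<in> carrier_mat d d" "Y \<in> carrier_mat d d" for X Y
    unfolding mat_trace_def using that
    by (auto intro!: sum.cong mat_mult_index simp del: index_mult_mat(1))
  show ?thesis
    using assms by (subst *, simp, simp, subst *, simp, simp, subst sum.swap) (simp add: mult.commute)
qed

lemma mat_adjoint_index:
  fixes A :: "complex mat"
  assumes "A \<in> carrier_mat d e" "i < e" "j < d"
  shows "mat_adjoint A $$ (i, j) = cnj (A $$ (j, i))"
  using assms by (auto simp: mat_adjoint_def mat_of_rows_def)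

lemma mat_adjoint_carrier:
  fixes A :: "complex mat"
  assumes "A \<in> carrier_mat d e"
  shows "mat_adjoint A \<in> carrier_mat e d"
  using assms by (auto simp: mat_adjoint_def)

text \<open>This carries orthonormality through a unitary: inner products with an image under the
  adjoint are computed from images under \<open>A\<close>.\<close>

lemma mat_adjoint_cscalar_prod:
  fixes A :: "complex mat"
  assumes "A \<in> carrier_mat d d" "u \<in> carrier_vec d" "v \<in> carrier_vec d"
  shows "(mat_adjoint A *\<^sub>v u) \<bullet>c v = u \<bullet>c (A *\<^sub>v v)"
proof -
  have adj: "(mat_adjoint A *\<^sub>v u) $ i = (\<Sum>j<d. cnj (A $$ (j, i)) * u $ j)" if "i < d" for i
    using assms that mat_adjoint_carrier[OF assms(1)]
    by (auto simp: scalar_prod_def atLeast0LessThan mat_adjoint_index[where d=d and e=d] intro!: sum.cong)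
  have mv: "(A *\<^sub>v v) $ i = (\<Sum>j<d. A $$ (i, j) * v $ j)" if "i < d" for i
    using assms that by (auto simp: scalar_prod_def atLeast0LessThan)
  have c: "mat_adjoint A *\<^sub>v u \<in> carrier_vec d" "A *\<^sub>v v \<in> carrier_vec d"
    using assms mat_adjoint_carrier[OF assms(1)] by auto
  show ?thesis
    using assms c adj mv
    by (simp add: cscalar_prod_sum sum_distrib_left sum_distrib_right del: index_mult_mat_vec)
       (subst sum.swap, simp add: mult_ac)
qed

section \<open>The quantum Fisher information\<close>

text \<open>If \<open>L\<^sub>1\<close> and \<open>L\<^sub>2\<close> are both symmetric logarithmic derivatives, then
  \<open>Tr (\<rho> L\<^sub>1\<^sup>2) = Tr (\<rho>' L\<^sub>1)\<close>, and the latter is \<open>Tr (\<rho> (L\<^sub>1 L\<^sub>2 + L\<^sub>2 L\<^sub>1)) / 2\<close>, which is symmetric.\<close>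

lemma SLD_trace_unique:
  assumes L1: "is_SLD d \<rho> \<theta> L1" and L2: "is_SLD d \<rho> \<theta> L2" and R: "\<rho> \<theta> \<in> carrier_mat d d"
  shows "mat_trace (\<rho> \<theta> * (L1 * L1)) = mat_trace (\<rho> \<theta> * (L2 * L2))"
proof -
  let ?R = "\<rho> \<theta>"
  have c: "L1 \<in> carrier_mat d d" "L2 \<in> carrier_mat d d"
    using L1 L2 by (auto simp: is_SLD_def hermitian_mat_def)
  define S where "S L = ?R * L + L * ?R" for L
  have Sc: "S L \<in> carrier_mat d d" if "L \<in> carrier_mat d d" for L
    using that R by (auto simp: S_def)
  \<comment> \<open>Entry by entry, both sides are twice the derivative of \<open>\<rho>\<close> at
    \<open>\<theta>\<close>, which is unique.\<close>
  have eq: "S L1 = S L2"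
  proof (rule eq_matI)
    fix i j assume "i < dim_row (S L2)" "j < dim_col (S L2)"
    then have ij: "i < d" "j < d" using Sc[OF c(2)] by auto
    have "((1 / 2) \<cdot>\<^sub>m S L1) $$ (i, j) = ((1 / 2) \<cdot>\<^sub>m S L2) $$ (i, j)"
      using L1 L2 ij unfolding is_SLD_def S_def by (metis vector_derivative_unique_at)
    then show "S L1 $$ (i, j) = S L2 $$ (i, j)"
      using Sc[OF c(1)] Sc[OF c(2)] ij by (auto simp del: index_mult_mat)
  qed (use Sc[OF c(1)] Sc[OF c(2)] in auto)
  have tr: "mat_trace (S L * M) = mat_trace (?R * (L * M)) + mat_trace (?R * (M * L))"
    if "L \<in> carrier_mat d d" "M \<in> carrier_mat d d" for L M
  proof -
    have "S L * M = ?R * L * M + L * ?R * M"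
      unfolding S_def using that R by (intro add_mult_distrib_mat) auto
    moreover have "mat_trace (L * ?R * M) = mat_trace (?R * (M * L))"
      using mat_trace_mult_commute[of L d "?R * M"] that R by simp
    ultimately show ?thesis
      using that R mat_trace_add[of "?R * L * M" d "L * ?R * M"] by simp
  qed
  have "2 * mat_trace (?R * (L1 * L1)) = mat_trace (S L1 * L1)" using tr c by simp
  also have "\<dots> = mat_trace (S L2 * L1)" by (simp only: eq)
  also have "\<dots> = mat_trace (S L1 * L2)" using tr c by (simp add: add.commute)
  also have "\<dots> = mat_trace (S L2 * L2)" by (simp only: eq)
  also have "\<dots> = 2 * mat_trace (?R * (L2 * L2))" using tr c by simp
  finally show ?thesis by simp
qed

text \<open>The \<open>SOME\<close> in \<open>quantum_fisher\<close> may pick any symmetric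
  logarithmic derivative. All of them give the same trace, so one explicit operator is enough to
  evaluate it.\<close>

lemma quantum_fisher_eq_trace:
  assumes "is_SLD d \<rho> \<theta> L" "\<rho> \<theta> \<in> carrier_mat d d"
  shows "quantum_fisher d \<rho> \<theta> = Re (mat_trace (\<rho> \<theta> * (L * L)))"
  unfolding quantum_fisher_def Let_def
  using SLD_trace_unique[OF someI[of "is_SLD d \<rho> \<theta>", OF assms(1)] assms] by simp

text \<open>The common form of \<open>psi_G\<close> and \<open>psi_Q\<close>, so that a single
  computation yields both quantum Fisher informations.\<close>

definition superposition :: "complex vec \<Rightarrow> complex vec \<Rightarrow> nat \<Rightarrow> real \<Rightarrow> complex vec" where
  "superposition e0 e1 N t =
     complex_of_real (cos (real N * t)) \<cdot>\<^sub>v e0 + complex_of_real (sin (real N * t)) \<cdot>\<^sub>v e1"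

definition orthonormal_pair :: "nat \<Rightarrow> complex vec \<Rightarrow> complex vec \<Rightarrow> bool" where
  "orthonormal_pair d e0 e1 \<longleftrightarrow> normalized_vec d e0 \<and> normalized_vec d e1 \<and> e0 \<bullet>c e1 = 0"

lemma superposition_carrier:
  "e0 \<in> carrier_vec d \<Longrightarrow> e1 \<in> carrier_vec d \<Longrightarrow> superposition e0 e1 N t \<in> carrier_vec d"
  by (auto simp: superposition_def)

lemma superposition_index:
  "e0 \<in> carrier_vec d \<Longrightarrow> e1 \<in> carrier_vec d \<Longrightarrow> i < d \<Longrightarrow>
   superposition e0 e1 N t $ i = cos (real N * t) * e0 $ i + sin (real N * t) * e1 $ i"
  by (auto simp: superposition_def)

text \<open>Real coefficients are unchanged by conjugation, so on the span of an orthonormal pair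
  the inner product is the Euclidean one of the plane.\<close>

lemma cscalar_prod_combination:
  fixes e0 e1 :: "complex vec"
  assumes "orthonormal_pair d e0 e1"
  shows "(complex_of_real a \<cdot>\<^sub>v e0 + complex_of_real b \<cdot>\<^sub>v e1) \<bullet>c
         (complex_of_real a' \<cdot>\<^sub>v e0 + complex_of_real b' \<cdot>\<^sub>v e1) = a * a' + b * b'"
proof -
  have c: "e0 \<in> carrier_vec d" "e1 \<in> carrier_vec d"
    using assms by (auto simp: orthonormal_pair_def normalized_vec_def)
  have s: "(\<Sum>i<d. e0 $ i * cnj (e0 $ i)) = 1" "(\<Sum>i<d. e1 $ i * cnj (e1 $ i)) = 1"
    "(\<Sum>i<d. e0 $ i * cnj (e1 $ i)) = 0"
    using assms c by (auto simp: orthonormal_pair_def normalized_vec_def cscalar_prod_sum)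
  have s': "(\<Sum>i<d. e1 $ i * cnj (e0 $ i)) = 0"
    using cscalar_prod_commute[OF c(2,1)] s(3) c by (simp add: cscalar_prod_sum)
  have "(complex_of_real a \<cdot>\<^sub>v e0 + complex_of_real b \<cdot>\<^sub>v e1) \<bullet>c
         (complex_of_real a' \<cdot>\<^sub>v e0 + complex_of_real b' \<cdot>\<^sub>v e1) =
     (\<Sum>i<d. a * a' * (e0 $ i * cnj (e0 $ i)) + a * b' * (e0 $ i * cnj (e1 $ i))
        + b * a' * (e1 $ i * cnj (e0 $ i)) + b * b' * (e1 $ i * cnj (e1 $ i)))"
    using c by (subst cscalar_prod_sum[where d=d]) (auto simp: algebra_simps intro!: sum.cong)
  also have "\<dots> = a * a' + b * b'"
    by (simp add: sum.distrib s s' flip: sum_distrib_left)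
  finally show ?thesis by simp
qed

lemma depolarized_carrier: "\<psi> \<in> carrier_vec d \<Longrightarrow> depolarized d r N \<psi> \<in> carrier_mat d d"
  by (auto simp: depolarized_def)

lemma depolarized_index:
  "\<psi> \<in> carrier_vec d \<Longrightarrow> i < d \<Longrightarrow> j < d \<Longrightarrow>
   depolarized d r N \<psi> $$ (i, j) =
     r ^ N * (\<psi> $ i * cnj (\<psi> $ j)) + complex_of_real ((1 - r ^ N) / d) * (if i = j then 1 else 0)"
  by (auto simp: depolarized_def ketbra_def)

text \<open>With \<open>q = r ^ N\<close> and \<open>a = (1 - q) / d\<close>, let \<open>v\<close>
  be the pure state and \<open>w\<close> its quarter turn in the plane of \<open>e0\<close> and
  \<open>e1\<close>. The derivative of the noisy state is \<open>q * N\<close> times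
  \<open>K = ketbra w v + ketbra v w\<close>. The anticommutator of \<open>K\<close> with the noisy
  state is \<open>q + 2 * a\<close> times \<open>K\<close>, so a multiple of \<open>K\<close> is a
  symmetric logarithmic derivative.\<close>

lemma quantum_fisher_depolarized:
  fixes r :: real
  assumes on: "orthonormal_pair d e0 e1" and r: "0 < r" "r \<le> 1" and d: "0 < d"
  shows "quantum_fisher d (\<lambda>t. depolarized d r N (superposition e0 e1 N t)) \<theta> =
     4 * (real N)\<^sup>2 * (r ^ N)\<^sup>2 / (2 * ((1 - r ^ N) / d) + r ^ N)"
proof -
  define q where "q = r ^ N"
  define a where "a = (1 - q) / d"
  have q: "0 < q" "q \<le> 1" using r by (auto simp: q_def power_le_one)
  have a: "0 \<le> a" using q by (auto simp: a_def)
  have c: "e0 \<in> carrier_vec d" "e1 \<in> carrier_vec d"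
    using on by (auto simp: orthonormal_pair_def normalized_vec_def)
  define C S where "C = cos (real N * \<theta>)" and "S = sin (real N * \<theta>)"
  have CS: "C * C + S * S = 1" by (simp add: C_def S_def flip: power2_eq_square)
  \<comment> \<open>The derivative of the pure state at \<open>\<theta>\<close> is \<open>N\<close>
    times \<open>w\<close>.\<close>
  define v w where "v = complex_of_real C \<cdot>\<^sub>v e0 + complex_of_real S \<cdot>\<^sub>v e1"
    and "w = complex_of_real (- S) \<cdot>\<^sub>v e0 + complex_of_real C \<cdot>\<^sub>v e1"
  have vw: "v \<in> carrier_vec d" "w \<in> carrier_vec d" using c by (auto simp: v_def w_def)
  have ip: "v \<bullet>c v = 1" "w \<bullet>c w = 1" "v \<bullet>c w = 0" "w \<bullet>c v = 0"
    unfolding v_def w_def cscalar_prod_combination[OF on] using CS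
    by (simp_all flip: of_real_mult of_real_add of_real_minus add: add.commute)
  define K where "K = ketbra w v + ketbra v w"
  define R where "R = complex_of_real q \<cdot>\<^sub>m ketbra v v + complex_of_real a \<cdot>\<^sub>m 1\<^sub>m d"
  have kc: "ketbra x y \<in> carrier_mat d d" if "x \<in> {v, w}" "y \<in> {v, w}" for x y
    using that vw by auto
  have K: "K \<in> carrier_mat d d" and R: "R \<in> carrier_mat d d" using kc by (auto simp: K_def R_def)
  have km: "ketbra x y * ketbra z u = (z \<bullet>c y) \<cdot>\<^sub>m ketbra x u"
    if "x \<in> {v, w}" "y \<in> {v, w}" "z \<in> {v, w}" "u \<in> {v, w}" for x y z u
    using that vw by (auto intro: ketbra_mult)
  \<comment> \<open>After \<open>km\<close> and \<open>ip\<close>, every product of rank-one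
    operators carries a scalar 0 or 1; \<open>one\<close> and \<open>sm\<close> remove it.\<close>
  have one: "1 \<cdot>\<^sub>m M = M" for M :: "complex mat"
    by (auto intro!: eq_matI)
  have sm: "0 \<cdot>\<^sub>m M + M' = M'" "M' + 0 \<cdot>\<^sub>m M = M'"
    if "M \<in> carrier_mat d d" "M' \<in> carrier_mat d d" for M M' :: "complex mat"
    using that by (auto intro!: eq_matI)
  note dist = mult_add_distrib_mat[where nr=d and n=d and nc=d] add_mult_distrib_mat[where nr=d and n=d and nc=d]
  have VK: "ketbra v v * K = ketbra v w" "K * ketbra v v = ketbra w v"
    unfolding K_def using kc by (simp_all add: dist km ip sm one)
  have VVK: "ketbra v w * K = ketbra v v"
    unfolding K_def using kc by (simp add: dist km ip sm one)
  have KK: "K * K = ketbra v v + ketbra w w"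
    unfolding K_def using kc by (simp add: dist km ip sm one)
  have RK: "R * M = complex_of_real q \<cdot>\<^sub>m (ketbra v v * M) + complex_of_real a \<cdot>\<^sub>m M"
    "M * R = complex_of_real q \<cdot>\<^sub>m (M * ketbra v v) + complex_of_real a \<cdot>\<^sub>m M"
    if "M \<in> carrier_mat d d" for M
    unfolding R_def using that kc[of v v]
    by (subst mult_add_distrib_mat add_mult_distrib_mat; 
        auto simp: mult_smult_assoc_mat[where nr=d and n=d and nc=d] mult_smult_distrib[where nr=d and n=d and nc=d])+
  \<comment> \<open>Solves \<open>\<kappa> / 2 * (q + 2 * a) = q * N\<close>, which matches half the
    anticommutator of \<open>R\<close> and \<open>\<kappa>\<close> times \<open>K\<close> with the
    derivative of the state.\<close>
  define \<kappa> where "\<kappa> = 2 * q * N / (q + 2 * a)"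
  have pos: "q + 2 * a \<noteq> 0" using q a by linarith
  then have \<kappa>: "\<kappa> * (q + 2 * a) = 2 * q * N" by (simp add: \<kappa>_def)
  define L where "L = complex_of_real \<kappa> \<cdot>\<^sub>m K"
  have L: "L \<in> carrier_mat d d" using K by (simp add: L_def)
  have anti: "((1/2) \<cdot>\<^sub>m (R * L + L * R)) $$ (i, j) = q * N * (K $$ (i, j))" if "i < d" "j < d" for i j
  proof -
    have "R * L = complex_of_real \<kappa> \<cdot>\<^sub>m (R * K)" "L * R = complex_of_real \<kappa> \<cdot>\<^sub>m (K * R)"
      using K R by (auto simp: L_def mult_smult_distrib mult_smult_assoc_mat)
    moreover have "R * K = complex_of_real q \<cdot>\<^sub>m ketbra v w + complex_of_real a \<cdot>\<^sub>m K"
      "K * R = complex_of_real q \<cdot>\<^sub>m ketbra w v + complex_of_real a \<cdot>\<^sub>m K"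
      using K by (simp_all add: RK VK)
    ultimately have "((1/2) \<cdot>\<^sub>m (R * L + L * R)) $$ (i, j) = \<kappa> / 2 * (q + 2 * a) * K $$ (i, j)"
      using that vw by (simp add: K_def ketbra_def algebra_simps)
    also have "\<kappa> / 2 * (q + 2 * a) = q * N"
      using \<kappa> by simp
    finally show ?thesis by simp
  qed
  have Kij: "K $$ (i, j) = w $ i * cnj (v $ j) + v $ i * cnj (w $ j)" if "i < d" "j < d" for i j
    using vw that by (auto simp: K_def ketbra_def)
  let ?\<rho> = "\<lambda>t. depolarized d r N (superposition e0 e1 N t)"
  have \<rho>: "?\<rho> \<theta> = R"
    by (simp add: depolarized_def R_def superposition_def v_def C_def S_def q_def a_def)
  have "hermitian_mat d L"
    unfolding hermitian_mat_def
  proof (intro conjI L eq_matI)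
    fix i j assume "i < dim_row L" "j < dim_col L"
    then have ij: "i < d" "j < d" using L by auto
    show "mat_adjoint L $$ (i, j) = L $$ (i, j)"
      using ij K by (simp add: mat_adjoint_index[OF L]) (simp add: L_def Kij add.commute)
  qed (use L mat_adjoint_carrier[OF L] in auto)
  moreover have "((\<lambda>t. ?\<rho> t $$ (i, j)) has_vector_derivative
      ((1 / 2) \<cdot>\<^sub>m (?\<rho> \<theta> * L + L * ?\<rho> \<theta>)) $$ (i, j)) (at \<theta>)" if ij: "i < d" "j < d" for i j
  proof -
    have cos': "((\<lambda>t. complex_of_real (cos (real N * t))) has_vector_derivative complex_of_real (- N * S)) (at \<theta>)"
      by (rule has_vector_derivative_of_real)
        (auto intro!: derivative_eq_intros simp: S_def simp flip: has_real_derivative_iff_has_vector_derivative)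
    have sin': "((\<lambda>t. complex_of_real (sin (real N * t))) has_vector_derivative complex_of_real (N * C)) (at \<theta>)"
      by (rule has_vector_derivative_of_real)
        (auto intro!: derivative_eq_intros simp: C_def simp flip: has_real_derivative_iff_has_vector_derivative)
    have f: "(\<lambda>t. ?\<rho> t $$ (i, j)) = (\<lambda>t. q * ((cos (real N * t) * e0 $ i + sin (real N * t) * e1 $ i) *
       (cos (real N * t) * cnj (e0 $ j) + sin (real N * t) * cnj (e1 $ j))) + a * (if i = j then 1 else 0))"
      using c ij superposition_carrier[OF c]
      by (intro ext, subst depolarized_index) (auto simp: superposition_index q_def a_def)
    \<comment> \<open>Stated for arbitrary \<open>x\<close> and \<open>y\<close> because the entries
      of the state and their conjugates have the same real coefficients.\<close>
    have D: "((\<lambda>t. complex_of_real (cos (real N * t)) * x + complex_of_real (sin (real N * t)) * y)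
        has_vector_derivative (complex_of_real (- N * S) * x + complex_of_real (N * C) * y)) (at \<theta>)" for x y
      by (intro has_vector_derivative_add has_vector_derivative_mult_left cos' sin')
    have "((\<lambda>t. ?\<rho> t $$ (i, j)) has_vector_derivative
       (q * ((C * e0 $ i + S * e1 $ i) * (complex_of_real (- N * S) * cnj (e0 $ j) + complex_of_real (N * C) * cnj (e1 $ j))
         + (complex_of_real (- N * S) * e0 $ i + complex_of_real (N * C) * e1 $ i) * (C * cnj (e0 $ j) + S * cnj (e1 $ j))) + 0))
       (at \<theta>)"
      unfolding f C_def S_def
      by (intro has_vector_derivative_add has_vector_derivative_const has_vector_derivative_mult_right
          has_vector_derivative_mult D[unfolded C_def S_def])
    also have "(q * ((C * e0 $ i + S * e1 $ i) * (complex_of_real (- N * S) * cnj (e0 $ j) + complex_of_real (N * C) * cnj (e1 $ j))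
         + (complex_of_real (- N * S) * e0 $ i + complex_of_real (N * C) * e1 $ i) * (C * cnj (e0 $ j) + S * cnj (e1 $ j))) + 0)
       = q * N * K $$ (i, j)"
      unfolding Kij[OF ij] using ij c by (simp add: v_def w_def algebra_simps)
    finally show ?thesis unfolding \<rho> anti[OF ij] .
  qed
  ultimately have "is_SLD d ?\<rho> \<theta> L" unfolding is_SLD_def by blast
  then have "quantum_fisher d ?\<rho> \<theta> = Re (mat_trace (R * (L * L)))"
    using quantum_fisher_eq_trace[of d ?\<rho> \<theta> L] R by (simp add: \<rho>)
  also have "R * (L * L) = complex_of_real (\<kappa>\<^sup>2) \<cdot>\<^sub>m (R * (K * K))"
  proof -
    have ss: "x \<cdot>\<^sub>m (y \<cdot>\<^sub>m M) = (x * y) \<cdot>\<^sub>m M" for x y :: complex and M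
      by (auto intro!: eq_matI)
    have "L * L = complex_of_real (\<kappa>\<^sup>2) \<cdot>\<^sub>m (K * K)"
      using K by (simp add: L_def mult_smult_distrib[where nr=d and n=d and nc=d] 
        mult_smult_assoc_mat[where nr=d and n=d and nc=d] power2_eq_square ss)
    then show ?thesis using K R by (simp add: mult_smult_distrib[where nr=d and n=d and nc=d])
  qed
  also have "mat_trace \<dots> = \<kappa>\<^sup>2 * mat_trace (R * (K * K))"
    using K R by (subst mat_trace_smult[where d=d]) auto
  \<comment> \<open>\<open>K * K\<close> is the projection onto the span of \<open>v\<close> and
    \<open>w\<close>, on which \<open>R\<close> has the eigenvalues \<open>q + a\<close> and
    \<open>a\<close>.\<close>
  also have "mat_trace (R * (K * K)) = q + 2 * a"
  proof -
    have "R * (K * K) = complex_of_real q \<cdot>\<^sub>m (ketbra v v * K * K) + complex_of_real a \<cdot>\<^sub>m (K * K)"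
      using RK(1)[of "K * K"] K kc[of v v] by (simp add: assoc_mult_mat[where ?n\<^sub>1.0=d and ?n\<^sub>2.0=d and ?n\<^sub>3.0=d and ?n\<^sub>4.0=d])
    also have "ketbra v v * K * K = ketbra v v" by (simp add: VK VVK)
    finally show ?thesis
      using vw ip by (simp add: KK mat_trace_add[where d=d] mat_trace_smult[where d=d] mat_trace_ketbra[where d=d])
  qed
  also have "Re (complex_of_real (\<kappa>\<^sup>2) * complex_of_real (q + 2 * a)) = \<kappa>\<^sup>2 * (q + 2 * a)"
    by (simp flip: of_real_mult)
  also have "\<dots> = 4 * (real N)\<^sup>2 * q\<^sup>2 / (2 * a + q)"
  proof -
    have "\<kappa>\<^sup>2 * (q + 2 * a) = (\<kappa> * (q + 2 * a))\<^sup>2 / (q + 2 * a)"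
      using pos by (simp add: power2_eq_square)
    then show ?thesis by (simp add: \<kappa> power_mult_distrib add.commute)
  qed
  finally show ?thesis by (simp add: q_def a_def)
qed

section \<open>The classical Fisher information\<close>

text \<open>If an outcome has probability 0, the denominator vanishes and division by 0 gives 0,
  which agrees with \<open>classical_fisher\<close> at such a point.\<close>

definition two_outcome_fisher :: "real \<Rightarrow> real \<Rightarrow> real \<Rightarrow> nat \<Rightarrow> real \<Rightarrow> real" where
  "two_outcome_fisher a b q N t =
     4 * (real N)\<^sup>2 * (q\<^sup>2 * (cos (real N * t))\<^sup>2 * (sin (real N * t))\<^sup>2
       / ((a + q * (cos (real N * t))\<^sup>2) * (b + q * (sin (real N * t))\<^sup>2)))"

text \<open>The two probabilities have opposite derivatives, so the two terms are
  \<open>x / P0\<close> and \<open>x / P1\<close> with the same \<open>x\<close>. Since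
  \<open>P0 + P1 = 1\<close>, they add up to \<open>x / (P0 * P1)\<close>.\<close>

lemma classical_fisher_two_outcome:
  assumes a: "0 \<le> a" and b: "0 \<le> b" and q: "0 < q" and sum: "a + b + q = 1"
    and p0: "\<And>t. p 0 t = a + q * (cos (real N * t))\<^sup>2"
    and p1: "\<And>t. p 1 t = b + q * (sin (real N * t))\<^sup>2"
  shows "classical_fisher p = two_outcome_fisher a b q N"
proof
  fix \<theta>
  let ?c = "cos (real N * \<theta>)" and ?s = "sin (real N * \<theta>)"
  define P0 P1 where "P0 = a + q * ?c\<^sup>2" and "P1 = b + q * ?s\<^sup>2"
  have nn: "P0 \<ge> 0" "P1 \<ge> 0" using a b q by (auto simp: P0_def P1_def)
  have "P0 + P1 = a + b + q * (?s\<^sup>2 + ?c\<^sup>2)"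
    unfolding P0_def P1_def by (simp only: algebra_simps)
  then have P: "P0 + P1 = 1" using sum by simp
  have d0: "(deriv (\<lambda>t. ln (p 0 t)) \<theta>)\<^sup>2 * P0 = 4 * N\<^sup>2 * q\<^sup>2 * ?c\<^sup>2 * ?s\<^sup>2 / P0"
  \<comment> \<open>If \<open>P0\<close> is 0, the left side vanishes through the factor
    \<open>P0\<close> and the right side through division by 0.\<close>
  proof (cases "P0 = 0")
    case False
    then have "P0 > 0" using nn by simp
    then have "((\<lambda>t. ln (p 0 t)) has_real_derivative (- 2 * N * q * ?c * ?s) / P0) (at \<theta>)"
      unfolding p0 P0_def by (auto intro!: derivative_eq_intros simp: field_simps)
    then show ?thesis using \<open>P0 > 0\<close> by (simp add: DERIV_imp_deriv power2_eq_square field_simps)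
  qed simp
  have d1: "(deriv (\<lambda>t. ln (p 1 t)) \<theta>)\<^sup>2 * P1 = 4 * N\<^sup>2 * q\<^sup>2 * ?c\<^sup>2 * ?s\<^sup>2 / P1"
  proof (cases "P1 = 0")
    case False
    then have "P1 > 0" using nn by simp
    then have "((\<lambda>t. ln (p 1 t)) has_real_derivative (2 * N * q * ?c * ?s) / P1) (at \<theta>)"
      unfolding p1 P1_def by (auto intro!: derivative_eq_intros simp: field_simps)
    then show ?thesis using \<open>P1 > 0\<close> by (simp add: DERIV_imp_deriv power2_eq_square field_simps)
  qed simp
  have "classical_fisher p \<theta> = (deriv (\<lambda>t. ln (p 0 t)) \<theta>)\<^sup>2 * P0 + (deriv (\<lambda>t. ln (p 1 t)) \<theta>)\<^sup>2 * P1"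
    using p0[of \<theta>] p1[of \<theta>] by (simp add: classical_fisher_def P0_def P1_def)
  also have "\<dots> = 4 * N\<^sup>2 * q\<^sup>2 * ?c\<^sup>2 * ?s\<^sup>2 / P0 + 4 * N\<^sup>2 * q\<^sup>2 * ?c\<^sup>2 * ?s\<^sup>2 / P1"
    by (simp only: d0 d1)
  also have "\<dots> = 4 * N\<^sup>2 * q\<^sup>2 * ?c\<^sup>2 * ?s\<^sup>2 / (P0 * P1)"
  proof (cases "P0 = 0 \<or> P1 = 0")
    case True
    \<comment> \<open>An outcome of probability 0 sits at a zero of \<open>cos\<close> or \<open>sin\<close>, so the other term vanishes too.\<close>
    then have "a + q * ?c\<^sup>2 = 0 \<or> b + q * ?s\<^sup>2 = 0" by (simp add: P0_def P1_def)
    then have "?c = 0 \<or> ?s = 0"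
      using a b q by (auto simp: add_nonneg_eq_0_iff)
    then show ?thesis by auto
  next
    case False
    then have "x / P0 + x / P1 = x * (P0 + P1) / (P0 * P1)" for x :: real
      by (simp add: field_simps)
    then show ?thesis using P by simp
  qed
  finally show "classical_fisher p \<theta> = two_outcome_fisher a b q N \<theta>"
    by (simp add: two_outcome_fisher_def P0_def P1_def mult.assoc)
qed

text \<open>The claim amounts to \<open>c * s * (2 * a + q) \<le> (a + q * c) * (b + q * s)\<close>.
  The difference of the two sides is a sum of terms that are nonnegative because
  \<open>a \<le> b\<close> and \<open>4 * (c * s) \<le> 1\<close>.\<close>

lemma two_outcome_fisher_le:
  assumes a: "0 \<le> a" and ab: "a \<le> b" and q: "0 < q" and sum: "a + b + q = 1"
  shows "two_outcome_fisher a b q N t \<le> 4 * (real N)\<^sup>2 * q\<^sup>2 / (2 * a + q)"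
proof -
  define c s where "c = (cos (real N * t))\<^sup>2" and "s = (sin (real N * t))\<^sup>2"
  have cs: "c \<ge> 0" "s \<ge> 0" "c + s = 1" by (auto simp: c_def s_def)
  have s: "s = 1 - c" using cs by simp
  have "4 * (c * s) \<le> 1" using zero_le_power2[of "1 - 2 * c"] unfolding s
    by (simp add: power2_eq_square algebra_simps)
  have k: "(a + q * c) * (b + q * s) - c * s * (2 * a + q) =
      (b - a) * (a * (1 - 2 * (c * s)) + q * c * (1 - s)) + (a\<^sup>2 + a * q) * (1 - 4 * (c * s))"
  proof -
    \<comment> \<open>The extra factor \<open>a + b + q\<close>, equal to 1, makes both sides
      homogeneous of degree 2 in \<open>a\<close>, \<open>b\<close>, \<open>q\<close>; the identity
      is then purely polynomial once \<open>s = 1 - c\<close>.\<close>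
    have "(a + q * c) * (b + q * s) - c * s * ((2 * a + q) * (a + b + q)) =
      (b - a) * (a * (1 - 2 * (c * s)) + q * c * (1 - s)) + (a\<^sup>2 + a * q) * (1 - 4 * (c * s))"
      unfolding s by (simp add: power2_eq_square algebra_simps)
    then show ?thesis using sum by simp
  qed
  have le: "c * s * (2 * a + q) \<le> (a + q * c) * (b + q * s)"
  proof -
    have "0 \<le> (b - a) * (a * (1 - 2 * (c * s)) + q * c * (1 - s)) + (a\<^sup>2 + a * q) * (1 - 4 * (c * s))"
      using \<open>4 * (c * s) \<le> 1\<close> a ab q cs
      by (intro add_nonneg_nonneg mult_nonneg_nonneg) auto
    then show ?thesis using k by simp
  qed
  have "q\<^sup>2 * c * s / ((a + q * c) * (b + q * s)) \<le> q\<^sup>2 / (2 * a + q)"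
  proof (cases "(a + q * c) * (b + q * s) = 0")
    case True
    then show ?thesis unfolding True using a q by simp
  next
    case False
    have "(a + q * c) * (b + q * s) \<ge> 0" using a ab q cs by (intro mult_nonneg_nonneg) auto
    then have pos: "(a + q * c) * (b + q * s) > 0" using False by linarith
    have "q\<^sup>2 * (c * s * (2 * a + q)) \<le> q\<^sup>2 * ((a + q * c) * (b + q * s))"
      using le by (intro mult_left_mono) auto
    then show ?thesis
      using pos a q by (simp add: divide_le_eq pos_le_divide_eq mult_ac)
  qed
  from mult_left_mono[OF this, of "4 * (real N)\<^sup>2"] show ?thesis
    by (simp add: two_outcome_fisher_def c_def s_def)
qed

lemma envelope_two_outcome_fisher_upper:
  assumes "0 \<le> a" "a \<le> b" "0 < q" "a + b + q = 1"
  shows "envelope (two_outcome_fisher a b q N) \<le> 4 * (real N)\<^sup>2 * q\<^sup>2 / (2 * a + q)"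
  unfolding envelope_def by (intro cSUP_least two_outcome_fisher_le assms) simp

text \<open>For \<open>N > 0\<close> the phase \<open>N * t\<close> takes every value, so \<open>c = cos\<^sup>2 (N * t)\<close> can be any point of
  \<open>[0, 1]\<close>.\<close>

lemma envelope_two_outcome_fisher_lower:
  assumes "0 \<le> a" "a \<le> b" "0 < q" "a + b + q = 1" and c: "0 \<le> c" "c \<le> 1"
  shows "4 * (real N)\<^sup>2 * (q\<^sup>2 * c * (1 - c) / ((a + q * c) * (b + q * (1 - c))))
    \<le> envelope (two_outcome_fisher a b q N)"
proof -
  \<comment> \<open>A real \<open>SUP\<close> is known to dominate the values only for a bounded
    family; \<open>two_outcome_fisher_le\<close> provides the bound.\<close>
  have up: "two_outcome_fisher a b q N t \<le> envelope (two_outcome_fisher a b q N)" for t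
    unfolding envelope_def
    by (intro cSUP_upper bdd_aboveI2[where M="4 * (real N)\<^sup>2 * q\<^sup>2 / (2 * a + q)"]
         two_outcome_fisher_le assms) simp
  show ?thesis
  proof (cases "N = 0")
    case True
    with up[of 0] show ?thesis by (simp add: two_outcome_fisher_def)
  next
    case False
    define t where "t = arccos (sqrt c) / N"
    have "cos (real N * t) = sqrt c"
      using False c by (simp add: t_def cos_arccos_abs real_sqrt_le_1_iff)
    then have "(cos (real N * t))\<^sup>2 = c" "(sin (real N * t))\<^sup>2 = 1 - c"
      using c by (simp_all add: sin_squared_eq)
    with up[of t] show ?thesis by (simp add: two_outcome_fisher_def)
  qed
qed

text \<open>At \<open>c = 1 / 2\<close> the two probabilities \<open>a + q / 2\<close> and \<open>b + q / 2\<close> add up to 1, so their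
  product is at most \<open>1 / 4\<close>, with equality only if \<open>a = b\<close>.\<close>

lemma envelope_two_outcome_fisher_half:
  assumes "0 \<le> a" "a \<le> b" "0 < q" "a + b + q = 1"
  shows "4 * (real N)\<^sup>2 * q\<^sup>2 \<le> envelope (two_outcome_fisher a b q N)"
    and "a < b \<Longrightarrow> 0 < N \<Longrightarrow> 4 * (real N)\<^sup>2 * q\<^sup>2 < envelope (two_outcome_fisher a b q N)"
proof -
  define D where "D = (a + q / 2) * (b + q / 2)"
  have D0: "D > 0" unfolding D_def using assms by (intro mult_pos_pos) auto
  have q: "q = 1 - a - b" using assms by simp
  \<comment> \<open>This is \<open>4 * x * y = (x + y)^2 - (x - y)^2\<close> for the two factors of
    \<open>D\<close>, whose sum is 1.\<close>
  have D4: "4 * D = 1 - (b - a)\<^sup>2" unfolding D_def q by (simp add: power2_eq_square field_simps)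
  have low: "4 * (real N)\<^sup>2 * (q\<^sup>2 / (4 * D)) \<le> envelope (two_outcome_fisher a b q N)"
    using envelope_two_outcome_fisher_lower[OF assms, of "1 / 2" N] by (simp add: D_def mult_ac)
  have "q\<^sup>2 \<le> q\<^sup>2 / (4 * D)"
    using D0 D4 by (simp add: pos_le_divide_eq mult_left_le)
  from mult_left_mono[OF this, of "4 * (real N)\<^sup>2"] low
  show "4 * (real N)\<^sup>2 * q\<^sup>2 \<le> envelope (two_outcome_fisher a b q N)" by simp
  assume "a < b" "0 < N"
  then have "4 * D < 1" using D4 by simp
  then have "q\<^sup>2 * (4 * D) < q\<^sup>2 * 1"
    using assms by (intro mult_strict_left_mono) auto
  then have "q\<^sup>2 < q\<^sup>2 / (4 * D)"
    using D0 by (simp add: pos_less_divide_eq)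
  from mult_strict_left_mono[OF this, of "4 * (real N)\<^sup>2"] low \<open>0 < N\<close>
  show "4 * (real N)\<^sup>2 * q\<^sup>2 < envelope (two_outcome_fisher a b q N)" by simp
qed

text \<open>For equal weights \<open>2 * a + q = 1\<close>, so the upper bound meets the lower bound
  from \<open>c = 1 / 2\<close>.\<close>

lemma envelope_two_outcome_fisher_symmetric:
  assumes "0 \<le> a" "0 < q" "a + a + q = 1"
  shows "envelope (two_outcome_fisher a a q N) = 4 * (real N)\<^sup>2 * q\<^sup>2"
proof (rule antisym)
  have "2 * a + q = 1" using assms by simp
  then show "envelope (two_outcome_fisher a a q N) \<le> 4 * (real N)\<^sup>2 * q\<^sup>2"
    using envelope_two_outcome_fisher_upper[of a a q N] assms by simp
  show "4 * (real N)\<^sup>2 * q\<^sup>2 \<le> envelope (two_outcome_fisher a a q N)"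
    using assms by (intro envelope_two_outcome_fisher_half) auto
qed

section \<open>The two estimation schemes\<close>

text \<open>Splits a sum over basis indices by the last qubit, which is the least significant binary
  digit.\<close>

lemma sum_even_odd:
  fixes f :: "nat \<Rightarrow> 'a::comm_monoid_add"
  shows "(\<Sum>i<m * 2. f i) = (\<Sum>k<m. f (2 * k) + f (Suc (2 * k)))"
  by (induction m) (simp_all add: ac_simps)

lemma tensor_ket_carrier: "\<psi> \<in> carrier_vec m \<Longrightarrow> tensor_vec \<psi> (ket b) \<in> carrier_vec (m * 2)"
  by (auto simp: tensor_vec_def ket_def)

lemma tensor_ket_index:
  assumes "\<psi> \<in> carrier_vec m" "k < m" "b < 2"
  shows "tensor_vec \<psi> (ket b) $ (2 * k) = (if b = 0 then \<psi> $ k else 0)"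
    and "tensor_vec \<psi> (ket b) $ (Suc (2 * k)) = (if b = 1 then \<psi> $ k else 0)"
proof -
  have "2 * k < m * 2" "Suc (2 * k) < m * 2" using assms(2) by auto
  then show "tensor_vec \<psi> (ket b) $ (2 * k) = (if b = 0 then \<psi> $ k else 0)"
    and "tensor_vec \<psi> (ket b) $ (Suc (2 * k)) = (if b = 1 then \<psi> $ k else 0)"
    using assms by (auto simp: tensor_vec_def ket_def)
qed

text \<open>The two vectors are supported on even and on odd indices, so they are orthogonal
  whatever the overlap of \<open>\<psi>0\<close> and \<open>\<psi>1\<close>.\<close>

lemma orthonormal_pair_tensor_ket:
  assumes "normalized_vec m \<psi>0" "normalized_vec m \<psi>1"
  shows "orthonormal_pair (m * 2) (tensor_vec \<psi>0 (ket 0)) (tensor_vec \<psi>1 (ket 1))"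
proof -
  have c: "\<psi>0 \<in> carrier_vec m" "\<psi>1 \<in> carrier_vec m"
    and s: "(\<Sum>i<m. \<psi>0 $ i * cnj (\<psi>0 $ i)) = 1" "(\<Sum>i<m. \<psi>1 $ i * cnj (\<psi>1 $ i)) = 1"
    using assms by (auto simp: normalized_vec_def cscalar_prod_sum)
  show ?thesis
    unfolding orthonormal_pair_def normalized_vec_def
    using c s tensor_ket_carrier[OF c(1)] tensor_ket_carrier[OF c(2)]
    by (auto simp: cscalar_prod_sum[where d="m * 2"] sum_even_odd tensor_ket_index)
qed

text \<open>The unitary \<open>A 0\<close> sends the all-zero state and \<open>\<phi>\<close> to the
  two tensor vectors, so the second pair inherits orthonormality from the first.\<close>

lemma amplitude_setup_orthonormal:
  assumes "amplitude_setup n A \<psi>0 \<psi>1 \<phi>"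
  shows "orthonormal_pair (2 ^ (n + 1)) (tensor_vec \<psi>0 (ket 0)) (tensor_vec \<psi>1 (ket 1))"
    and "orthonormal_pair (2 ^ (n + 1)) (ket_zeros (n + 1)) \<phi>"
proof -
  let ?d = "2 ^ (n + 1)"
  let ?z = "ket_zeros (n + 1)"
  define e0 e1 where "e0 = tensor_vec \<psi>0 (ket 0)" and "e1 = tensor_vec \<psi>1 (ket 1)"
  \<comment> \<open>The setup holds for every \<open>\<theta>\<close> with the same
    \<open>\<phi>\<close>; at \<open>\<theta> = 0\<close> the trigonometric combinations reduce to
    \<open>e0\<close> and \<open>e1\<close>.\<close>
  define U where "U = A 0"
  have on: "orthonormal_pair ?d e0 e1"
    using assms orthonormal_pair_tensor_ket[of "2 ^ n" \<psi>0 \<psi>1]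
    by (simp add: amplitude_setup_def e0_def e1_def mult.commute)
  then have e: "e0 \<in> carrier_vec ?d" "e1 \<in> carrier_vec ?d" "e0 \<bullet>c e1 = 0" "e1 \<bullet>c e1 = 1"
    by (auto simp: orthonormal_pair_def normalized_vec_def)
  have *: "unitary_mat ?d U \<and> U *\<^sub>v ?z = complex_of_real (cos 0) \<cdot>\<^sub>v e0 + complex_of_real (sin 0) \<cdot>\<^sub>v e1 \<and>
      \<phi> = mat_adjoint U *\<^sub>v (complex_of_real (- sin 0) \<cdot>\<^sub>v e0 + complex_of_real (cos 0) \<cdot>\<^sub>v e1)"
    using assms unfolding amplitude_setup_def U_def e0_def e1_def by blast
  then have U: "U \<in> carrier_mat ?d ?d" "U * mat_adjoint U = 1\<^sub>m ?d" by (auto simp: unitary_mat_def)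
  have [simp]: "1 \<cdot>\<^sub>v v = v" "0 \<cdot>\<^sub>v v = 0\<^sub>v (dim_vec v)" for v :: "complex vec" by (auto intro!: eq_vecI)
  have Uz: "U *\<^sub>v ?z = e0" and \<phi>: "\<phi> = mat_adjoint U *\<^sub>v e1" using * e by auto
  have Ua: "mat_adjoint U \<in> carrier_mat ?d ?d" using U mat_adjoint_carrier by blast
  have \<phi>c: "\<phi> \<in> carrier_vec ?d" using \<phi> Ua e by auto
  have zc: "?z \<in> carrier_vec ?d" by (simp add: ket_zeros_def)
  have "\<phi> \<bullet>c ?z = e1 \<bullet>c e0"
    using mat_adjoint_cscalar_prod[OF U(1) e(2) zc] Uz \<phi> by simp
  then have "\<phi> \<bullet>c ?z = 0" using cscalar_prod_commute[OF e(2,1)] e by simp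
  then have 1: "?z \<bullet>c \<phi> = 0" using cscalar_prod_commute[OF zc \<phi>c] by simp
  have "U *\<^sub>v \<phi> = (U * mat_adjoint U) *\<^sub>v e1"
    using \<phi> U(1) Ua e by (simp add: assoc_mult_mat_vec[where ?n\<^sub>1.0="?d" and ?n\<^sub>2.0="?d" and ?n\<^sub>3.0="?d"])
  then have "U *\<^sub>v \<phi> = e1" using U e by simp
  then have 2: "\<phi> \<bullet>c \<phi> = 1"
    using mat_adjoint_cscalar_prod[OF U(1) e(2) \<phi>c] \<phi> e by simp
  have 3: "?z \<bullet>c ?z = 1"
    using zc by (simp add: ket_zeros_def)
  show "orthonormal_pair ?d (tensor_vec \<psi>0 (ket 0)) (tensor_vec \<psi>1 (ket 1))"
    using on by (simp add: e0_def e1_def)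
  show "orthonormal_pair ?d ?z \<phi>"
    using 1 2 3 \<phi>c zc by (simp add: orthonormal_pair_def normalized_vec_def)
qed

section \<open>Closed forms of the four Fisher informations\<close>

lemma rho_G_eq:
  "rho_G n r \<psi>0 \<psi>1 N = (\<lambda>t. depolarized (2 ^ (n + 1)) r N
     (superposition (tensor_vec \<psi>0 (ket 0)) (tensor_vec \<psi>1 (ket 1)) N t))"
  by (auto simp: rho_G_def psi_G_def superposition_def)

lemma rho_Q_eq:
  "rho_Q n r \<phi> N = (\<lambda>t. depolarized (2 ^ (n + 1)) r N (superposition (ket_zeros (n + 1)) \<phi> N t))"
  by (auto simp: rho_Q_def psi_Q_def superposition_def)

lemma Fq_eq:
  assumes "amplitude_setup n A \<psi>0 \<psi>1 \<phi>" "0 < r" "r \<le> 1"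
  shows "Fq_G n r \<psi>0 \<psi>1 N \<theta> = 4 * (real N)\<^sup>2 * (r ^ N)\<^sup>2 / (2 * ((1 - r ^ N) / 2 ^ (n + 1)) + r ^ N)"
    and "Fq_Q n r \<phi> N \<theta> = 4 * (real N)\<^sup>2 * (r ^ N)\<^sup>2 / (2 * ((1 - r ^ N) / 2 ^ (n + 1)) + r ^ N)"
  unfolding Fq_G_def Fq_Q_def rho_G_eq rho_Q_eq
  using amplitude_setup_orthonormal[OF assms(1)] assms(2,3)
  by (auto simp: quantum_fisher_depolarized)

lemma E_G_index:
  assumes "k < 2 ^ (n + 1)" "j < 2 ^ (n + 1)" "i < 2"
  shows "E_G n i $$ (k, j) = (if k = j \<and> j mod 2 = i then 1 else 0)"
proof -
  have "k div 2 < 2 ^ n" "j div 2 < 2 ^ n" using assms by auto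
  moreover have "k = j \<longleftrightarrow> k div 2 = j div 2 \<and> k mod 2 = j mod 2"
    by (metis div_mult_mod_eq)
  ultimately show ?thesis
    using assms by (auto simp: E_G_def tensor_mat_def ketbra_def ket_def mult.commute)
qed

text \<open>Each outcome sums the diagonal entries of one parity: the \<open>2 ^ n\<close> noise
  terms add up to \<open>(1 - r ^ N) / 2\<close>, and the norm of \<open>\<psi>0\<close> or
  \<open>\<psi>1\<close> leaves a squared cosine or sine.\<close>

lemma Fc_G_eq:
  assumes "amplitude_setup n A \<psi>0 \<psi>1 \<phi>" "0 < r" "r \<le> 1"
  shows "Fc_G n r \<psi>0 \<psi>1 N = two_outcome_fisher ((1 - r ^ N) / 2) ((1 - r ^ N) / 2) (r ^ N) N"
proof -
  let ?d = "2 ^ (n + 1) :: nat"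
  have c: "\<psi>0 \<in> carrier_vec (2 ^ n)" "\<psi>1 \<in> carrier_vec (2 ^ n)"
    and s: "(\<Sum>i<2 ^ n. \<psi>0 $ i * cnj (\<psi>0 $ i)) = 1" "(\<Sum>i<2 ^ n. \<psi>1 $ i * cnj (\<psi>1 $ i)) = 1"
    using assms by (auto simp: amplitude_setup_def normalized_vec_def cscalar_prod_sum)
  have d: "?d = 2 ^ n * 2" by simp
  have pc: "psi_G \<psi>0 \<psi>1 N t \<in> carrier_vec ?d" for t
    unfolding d psi_G_def using tensor_ket_carrier[OF c(1)] tensor_ket_carrier[OF c(2)] by auto
  have pi: "psi_G \<psi>0 \<psi>1 N t $ (2 * k) = cos (real N * t) * \<psi>0 $ k"
    "psi_G \<psi>0 \<psi>1 N t $ (Suc (2 * k)) = sin (real N * t) * \<psi>1 $ k" if "k < 2 ^ n" for t k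
    using that c tensor_ket_carrier[OF c(1), of 0] tensor_ket_carrier[OF c(2), of 1]
    by (auto simp: psi_G_def tensor_ket_index)
  have tr: "mat_trace (rho_G n r \<psi>0 \<psi>1 N t * E_G n i) =
      (\<Sum>j<?d. if j mod 2 = i then rho_G n r \<psi>0 \<psi>1 N t $$ (j, j) else 0)" if i: "i < 2" for i t
  proof -
    have R: "rho_G n r \<psi>0 \<psi>1 N t \<in> carrier_mat ?d ?d"
      using depolarized_carrier[OF pc] by (simp add: rho_G_def)
    have E: "E_G n i \<in> carrier_mat ?d ?d" by (auto simp: E_G_def tensor_mat_def ketbra_def ket_def)
    have "mat_trace (rho_G n r \<psi>0 \<psi>1 N t * E_G n i) =
      (\<Sum>j<?d. \<Sum>k<?d. rho_G n r \<psi>0 \<psi>1 N t $$ (j, k) * E_G n i $$ (k, j))"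
      unfolding mat_trace_def using R E
      by (intro sum.cong mat_mult_index) auto
    also have "\<dots> = (\<Sum>j<?d. \<Sum>k<?d. if k = j then (if j mod 2 = i then rho_G n r \<psi>0 \<psi>1 N t $$ (j, j) else 0) else 0)"
      using i by (intro sum.cong refl) (auto simp: E_G_index simp del: power_Suc)
    also have "\<dots> = (\<Sum>j<?d. if j mod 2 = i then rho_G n r \<psi>0 \<psi>1 N t $$ (j, j) else 0)"
      by (intro sum.cong refl) (simp del: power_Suc)
    finally show ?thesis .
  qed
  have di: "rho_G n r \<psi>0 \<psi>1 N t $$ (j, j) =
      r ^ N * (psi_G \<psi>0 \<psi>1 N t $ j * cnj (psi_G \<psi>0 \<psi>1 N t $ j)) + (1 - r ^ N) / 2 ^ (n + 1)"
    if "j < ?d" for j t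
    using depolarized_index[OF pc that that] by (simp add: rho_G_def)
  have lt2: "(0::nat) < 2" "(1::nat) < 2" by simp_all
  have t0: "mat_trace (rho_G n r \<psi>0 \<psi>1 N t * E_G n 0) =
      complex_of_real ((1 - r ^ N) / 2 + r ^ N * (cos (real N * t))\<^sup>2)" for t
  proof -
    have "mat_trace (rho_G n r \<psi>0 \<psi>1 N t * E_G n 0) = (\<Sum>k<2 ^ n. rho_G n r \<psi>0 \<psi>1 N t $$ (2 * k, 2 * k))"
      unfolding tr[OF lt2(1)] unfolding d sum_even_odd by (intro sum.cong) auto
    also have "\<dots> = (\<Sum>k<2 ^ n. r ^ N * (cos (real N * t))\<^sup>2 * (\<psi>0 $ k * cnj (\<psi>0 $ k)) + (1 - r ^ N) / 2 ^ (n + 1))"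
      by (intro sum.cong refl) (simp add: di pi power2_eq_square)
    also have "\<dots> = complex_of_real ((1 - r ^ N) / 2 + r ^ N * (cos (real N * t))\<^sup>2)"
      by (simp add: sum.distrib s flip: sum_distrib_left)
    finally show ?thesis .
  qed
  have t1: "mat_trace (rho_G n r \<psi>0 \<psi>1 N t * E_G n 1) =
      complex_of_real ((1 - r ^ N) / 2 + r ^ N * (sin (real N * t))\<^sup>2)" for t
  proof -
    have "mat_trace (rho_G n r \<psi>0 \<psi>1 N t * E_G n 1) = (\<Sum>k<2 ^ n. rho_G n r \<psi>0 \<psi>1 N t $$ (Suc (2 * k), Suc (2 * k)))"
      unfolding tr[OF lt2(2)] unfolding d sum_even_odd by (intro sum.cong) auto
    also have "\<dots> = (\<Sum>k<2 ^ n. r ^ N * (sin (real N * t))\<^sup>2 * (\<psi>1 $ k * cnj (\<psi>1 $ k)) + (1 - r ^ N) / 2 ^ (n + 1))"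
      by (intro sum.cong refl) (simp add: di pi power2_eq_square)
    also have "\<dots> = complex_of_real ((1 - r ^ N) / 2 + r ^ N * (sin (real N * t))\<^sup>2)"
      by (simp add: sum.distrib s flip: sum_distrib_left)
    finally show ?thesis .
  qed
  show ?thesis
    unfolding Fc_G_def
    by (rule classical_fisher_two_outcome)
      (use assms(2,3) in \<open>auto simp: outcome_prob_def t0 t1[unfolded One_nat_def] power_le_one simp del: of_real_add\<close>)
qed

text \<open>The first probability depends only on the overlap with the all-zero state. The second is
  its complement, because the state has trace 1.\<close>

lemma Fc_Q_eq:
  assumes "amplitude_setup n A \<psi>0 \<psi>1 \<phi>" "0 < r" "r \<le> 1"
  shows "Fc_Q n r \<phi> N = two_outcome_fisher ((1 - r ^ N) / 2 ^ (n + 1))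
    ((2 ^ (n + 1) - 1) * ((1 - r ^ N) / 2 ^ (n + 1))) (r ^ N) N"
proof -
  let ?d = "2 ^ (n + 1) :: nat" and ?z = "ket_zeros (n + 1)"
  define a where "a = (1 - r ^ N) / 2 ^ (n + 1)"
  note on = amplitude_setup_orthonormal(2)[OF assms(1)]
  have c: "?z \<in> carrier_vec ?d" "\<phi> \<in> carrier_vec ?d" and z\<phi>: "?z \<bullet>c \<phi> = 0" and zz: "?z \<bullet>c ?z = 1"
    using on by (auto simp: orthonormal_pair_def normalized_vec_def)
  let ?\<psi> = "superposition ?z \<phi> N"
  have pc: "?\<psi> t \<in> carrier_vec ?d" for t using superposition_carrier[OF c] .
  have R: "rho_Q n r \<phi> N t \<in> carrier_mat ?d ?d" for t
    using depolarized_carrier[OF pc] by (simp add: rho_Q_eq)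
  define P where "P = ketbra ?z ?z"
  have P: "P \<in> carrier_mat ?d ?d" using c by (simp add: P_def)
  have tR: "mat_trace (rho_Q n r \<phi> N t) = 1" for t
  proof -
    have "?\<psi> t \<bullet>c ?\<psi> t = 1"
      unfolding superposition_def cscalar_prod_combination[OF on]
      by (simp flip: power2_eq_square of_real_add of_real_power)
    then have "mat_trace (rho_Q n r \<phi> N t) = r ^ N + a * 2 ^ (n + 1)"
      unfolding rho_Q_eq depolarized_def using pc
      by (simp add: mat_trace_add[where d="?d"] mat_trace_smult[where d="?d"] mat_trace_ketbra[where d="?d"]
           mat_trace_one a_def del: power_Suc)
    then show ?thesis by (simp add: a_def)
  qed
  have t0: "mat_trace (rho_Q n r \<phi> N t * P) = complex_of_real (a + r ^ N * (cos (real N * t))\<^sup>2)" for t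
  proof -
    \<comment> \<open>Puts the all-zero state into the form that
      \<open>cscalar_prod_combination\<close> expects.\<close>
    have z: "complex_of_real 1 \<cdot>\<^sub>v ?z + complex_of_real 0 \<cdot>\<^sub>v \<phi> = ?z"
      using c by (auto intro!: eq_vecI)
    have p: "?\<psi> t \<bullet>c ?z = cos (real N * t)"
      using cscalar_prod_combination[OF on, of "cos (real N * t)" "sin (real N * t)" 1 0] z
      by (simp add: superposition_def del: power_Suc)
    have p': "?z \<bullet>c ?\<psi> t = cos (real N * t)"
      using cscalar_prod_commute[OF c(1) pc] p by simp
    have "rho_Q n r \<phi> N t * P = complex_of_real (r ^ N) \<cdot>\<^sub>m (ketbra (?\<psi> t) (?\<psi> t) * P) + complex_of_real a \<cdot>\<^sub>m P"
      unfolding rho_Q_eq depolarized_def a_def using P pc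
      by (subst add_mult_distrib_mat[where nr="?d" and n="?d" and nc="?d"]) 
        (auto simp: mult_smult_assoc_mat[where nr="?d" and n="?d" and nc="?d"] simp del: power_Suc)
    also have "ketbra (?\<psi> t) (?\<psi> t) * P = cos (real N * t) \<cdot>\<^sub>m ketbra (?\<psi> t) ?z"
      unfolding P_def using ketbra_mult[OF pc pc c(1) c(1)] p' by simp
    finally show ?thesis
      using P pc c p zz
      by (simp add: mat_trace_add[where d="?d"] mat_trace_smult[where d="?d"] mat_trace_ketbra[where d="?d"]
           P_def power2_eq_square del: power_Suc)
  qed
  have "a + (2 ^ (n + 1) - 1) * a = 2 ^ (n + 1) * a" by (simp add: algebra_simps)
  then have b: "a + (2 ^ (n + 1) - 1) * a + r ^ N = 1" by (simp add: a_def)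
  have t1: "mat_trace (rho_Q n r \<phi> N t * (1\<^sub>m ?d - P)) =
      complex_of_real ((2 ^ (n + 1) - 1) * a + r ^ N * (sin (real N * t))\<^sup>2)" for t
  proof -
    have "rho_Q n r \<phi> N t * (1\<^sub>m ?d - P) = rho_Q n r \<phi> N t - rho_Q n r \<phi> N t * P"
      using R[of t] P by (simp add: mult_minus_distrib_mat[where nr="?d" and n="?d" and nc="?d"] del: power_Suc)
    then have "mat_trace (rho_Q n r \<phi> N t * (1\<^sub>m ?d - P)) =
        complex_of_real (1 - (a + r ^ N * (cos (real N * t))\<^sup>2))"
      using R[of t] P mat_trace_minus[of _ "?d" "rho_Q n r \<phi> N t * P"] by (simp add: tR t0 del: power_Suc)
    also have "1 - (a + r ^ N * (cos (real N * t))\<^sup>2) = (2 ^ (n + 1) - 1) * a + r ^ N * (sin (real N * t))\<^sup>2"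
      using b unfolding sin_squared_eq by (simp only: algebra_simps)
    finally show ?thesis .
  qed
  have a0: "0 \<le> a" using assms(2,3) by (simp add: a_def power_le_one)
  have b0: "0 \<le> (2 ^ (n + 1) - 1) * a"
    using a0 one_le_power[of "2::real" "n + 1"] by (intro mult_nonneg_nonneg) (simp_all del: power_Suc)
  have E: "E_Q n 0 = P" "E_Q n 1 = 1\<^sub>m ?d - P" by (simp_all add: E_Q_def P_def)
  show ?thesis
    unfolding Fc_Q_def a_def[symmetric]
    by (rule classical_fisher_two_outcome)
      (use assms(2,3) a0 b b0 in \<open>simp_all only: outcome_prob_def E t0 t1 Re_complex_of_real zero_less_power\<close>)
qed

text \<open>With \<open>d = 2 ^ (n + 1)\<close>, the weights satisfy
  \<open>a + b = d * a = 1 - q\<close> and \<open>b - a = (d - 2) * a\<close>. The gap is therefore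
  positive exactly when \<open>d > 2\<close> and \<open>q < 1\<close>.\<close>

lemma noise_weights:
  fixes q :: real
  assumes "0 < q" "q \<le> 1"
  defines "a n \<equiv> (1 - q) / 2 ^ (n + 1)" and "b n \<equiv> (2 ^ (n + 1) - 1) * ((1 - q) / 2 ^ (n + 1))"
  shows "0 \<le> a n" "a n \<le> b n" "a n + b n + q = 1" "q < 1 \<Longrightarrow> 0 < n \<Longrightarrow> a n < b n"
proof -
  have p: "(1::real) \<le> 2 ^ n" by simp
  show "0 \<le> a n" using assms by (simp add: a_def)
  have "b n - a n = (2 ^ (n + 1) - 1) * a n - a n" by (simp only: a_def b_def)
  also have "\<dots> = (2 * 2 ^ n - 2) * a n" by (simp add: algebra_simps)
  finally have ba: "b n - a n = (2 * 2 ^ n - 2) * a n" .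
  have "0 \<le> (2 * 2 ^ n - 2) * a n" using p \<open>0 \<le> a n\<close> by (intro mult_nonneg_nonneg) auto
  then show "a n \<le> b n" using ba by simp
  have "a n + b n = a n + (2 ^ (n + 1) - 1) * a n" by (simp only: a_def b_def)
  also have "\<dots> = 2 ^ (n + 1) * a n" by (simp add: algebra_simps)
  finally have "a n + b n = 2 ^ (n + 1) * a n" .
  then show "a n + b n + q = 1" by (simp add: a_def)
  assume "q < 1" "0 < n"
  then have "0 < a n" "(1::real) < 2 ^ n" by (auto simp: a_def)
  then have "0 < (2 * 2 ^ n - 2) * a n" by (intro mult_pos_pos) auto
  then show "a n < b n" using ba by simp
qed

text \<open>Write \<open>a + q * c = (a / c + q) * c\<close> and cancel \<open>c\<close>. Here
  \<open>a / c\<close> tends to 0 because a linear factor is divided by a power of 2, and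
  \<open>b + q * (1 - c)\<close> tends to 1, which leaves \<open>q^2 / q\<close>.\<close>

lemma lower_bound_limit:
  fixes q :: real
  assumes "0 < q" "q \<le> 1"
  defines "a n \<equiv> (1 - q) / 2 ^ (n + 1)" and "b n \<equiv> (2 ^ (n + 1) - 1) * ((1 - q) / 2 ^ (n + 1))"
    and "c n \<equiv> 1 / real (n + 2)"
  shows "(\<lambda>n. q\<^sup>2 * c n * (1 - c n) / ((a n + q * c n) * (b n + q * (1 - c n)))) \<longlonglongrightarrow> q"
proof -
  have c0: "c \<longlonglongrightarrow> 0" unfolding c_def by real_asymp
  \<comment> \<open>The factor \<open>1 - q\<close>, possibly 0, is kept apart so that the remaining
    limit is free of parameters.\<close>
  have ac: "(\<lambda>n. (1 - q) * (real (n + 2) / 2 ^ (n + 1))) \<longlonglongrightarrow> (1 - q) * 0"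
    by (intro tendsto_mult tendsto_const) real_asymp
  have a0: "(\<lambda>n. (1 - q) * (1 / 2 ^ (n + 1))) \<longlonglongrightarrow> (1 - q) * 0"
    by (intro tendsto_mult tendsto_const) real_asymp
  have b: "b n = 1 - q - (1 - q) * (1 / 2 ^ (n + 1))" for n by (simp add: b_def field_simps)
  have "(\<lambda>n. q\<^sup>2 * (1 - c n) / (((1 - q) * (real (n + 2) / 2 ^ (n + 1)) + q) * (b n + q * (1 - c n))))
     \<longlonglongrightarrow> q\<^sup>2 * (1 - 0) / (((1 - q) * 0 + q) * ((1 - q - (1 - q) * 0) + q * (1 - 0)))"
    unfolding b using assms(1) by (intro tendsto_intros c0 ac a0) auto
  moreover have "q\<^sup>2 * (1 - c n) / (((1 - q) * (real (n + 2) / 2 ^ (n + 1)) + q) * (b n + q * (1 - c n))) =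
     q\<^sup>2 * c n * (1 - c n) / ((a n + q * c n) * (b n + q * (1 - c n)))" for n
  proof -
    have "a n + q * c n = ((1 - q) * (real (n + 2) / 2 ^ (n + 1)) + q) * c n"
      by (simp add: a_def c_def field_simps)
    moreover have "c n \<noteq> 0" by (simp add: c_def)
    ultimately show ?thesis by (simp add: mult_ac)
  qed
  ultimately show ?thesis using assms(1) by (simp add: power2_eq_square)
qed

text \<open>If \<open>r = 1\<close> or \<open>N = 0\<close>, both envelopes and the quantum Fisher
  information coincide in every dimension. The necessity of \<open>d = 2\<close> is therefore
  claimed for \<open>r < 1\<close> and \<open>0 < N\<close>. In the limit, each \<open>n\<close> has
  its own unitaries and states.\<close>

theorem mainTheorem3:
  fixes r :: real and N :: nat
  assumes "0 < r" and "r \<le> 1"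
  shows
    "(\<forall>n A \<psi>0 \<psi>1 \<phi> \<theta>. amplitude_setup n A \<psi>0 \<psi>1 \<phi> \<longrightarrow>
        envelope (Fc_G n r \<psi>0 \<psi>1 N) \<le> envelope (Fc_Q n r \<phi> N) \<and>
        envelope (Fc_Q n r \<phi> N) \<le> Fq_Q n r \<phi> N \<theta> \<and>
        Fq_Q n r \<phi> N \<theta> = Fq_G n r \<psi>0 \<psi>1 N \<theta>)
     \<and>
     (\<forall>n A \<psi>0 \<psi>1 \<phi> \<theta>. amplitude_setup n A \<psi>0 \<psi>1 \<phi> \<longrightarrow>
        (r < 1 \<longrightarrow> 0 < N \<longrightarrow>
           envelope (Fc_G n r \<psi>0 \<psi>1 N) = envelope (Fc_Q n r \<phi> N) \<longrightarrow>
           (2::nat) ^ (n + 1) = 2) \<and>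
        ((2::nat) ^ (n + 1) = 2 \<longrightarrow>
           envelope (Fc_G n r \<psi>0 \<psi>1 N) = envelope (Fc_Q n r \<phi> N) \<and>
           envelope (Fc_Q n r \<phi> N) = Fq_Q n r \<phi> N \<theta>))
     \<and>
     (\<forall>A \<psi>0 \<psi>1 \<phi> \<theta>. (\<forall>n. amplitude_setup n (A n) (\<psi>0 n) (\<psi>1 n) (\<phi> n)) \<longrightarrow>
        (\<lambda>n. envelope (Fc_Q n r (\<phi> n) N) - Fq_Q n r (\<phi> n) N \<theta>) \<longlonglongrightarrow> 0)"
proof (intro conjI allI impI)
  define q where "q = r ^ N"
  have q: "0 < q" "q \<le> 1" using assms by (auto simp: q_def power_le_one)
  define a b where "a n = (1 - q) / 2 ^ (n + 1)" and "b n = (2 ^ (n + 1) - 1) * ((1 - q) / 2 ^ (n + 1))" for n :: nat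
  note w = noise_weights[OF q, folded a_def b_def]
  have FcQ: "Fc_Q n r \<phi> N = two_outcome_fisher (a n) (b n) q N"
    and FcG: "envelope (Fc_G n r \<psi>0 \<psi>1 N) = 4 * (real N)\<^sup>2 * q\<^sup>2"
    and FqQ: "Fq_Q n r \<phi> N \<theta> = 4 * (real N)\<^sup>2 * q\<^sup>2 / (2 * a n + q)"
    and FqG: "Fq_G n r \<psi>0 \<psi>1 N \<theta> = 4 * (real N)\<^sup>2 * q\<^sup>2 / (2 * a n + q)"
    if "amplitude_setup n A \<psi>0 \<psi>1 \<phi>" for n A \<psi>0 \<psi>1 \<phi> \<theta>
    using Fc_Q_eq[OF that assms, of N] Fq_eq[OF that assms, of N \<theta>] Fc_G_eq[OF that assms, of N]
      envelope_two_outcome_fisher_symmetric[of "(1 - q) / 2" q N] q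
    by (simp_all add: a_def b_def q_def)
  have mono: "envelope (Fc_G n r \<psi>0 \<psi>1 N) \<le> envelope (Fc_Q n r \<phi> N)"
    and upper: "envelope (Fc_Q n r \<phi> N) \<le> Fq_Q n r \<phi> N \<theta>"
    if "amplitude_setup n A \<psi>0 \<psi>1 \<phi>" for n A \<psi>0 \<psi>1 \<phi> \<theta>
    using envelope_two_outcome_fisher_half(1)[of "a n" "b n" q N]
      envelope_two_outcome_fisher_upper[of "a n" "b n" q N] w q
    by (simp_all add: FcQ[OF that] FcG[OF that] FqQ[OF that])
  {
    fix n A \<psi>0 \<psi>1 \<phi> \<theta> assume set: "amplitude_setup n A \<psi>0 \<psi>1 \<phi>"
    show "envelope (Fc_G n r \<psi>0 \<psi>1 N) \<le> envelope (Fc_Q n r \<phi> N)" by (rule mono[OF set])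
    show "envelope (Fc_Q n r \<phi> N) \<le> Fq_Q n r \<phi> N \<theta>" by (rule upper[OF set])
    show "Fq_Q n r \<phi> N \<theta> = Fq_G n r \<psi>0 \<psi>1 N \<theta>" by (simp add: FqQ[OF set] FqG[OF set])
    show "(2::nat) ^ (n + 1) = 2"
      if "r < 1" "0 < N" and eq: "envelope (Fc_G n r \<psi>0 \<psi>1 N) = envelope (Fc_Q n r \<phi> N)"
    proof -
      have "q < 1" using that assms by (simp add: q_def power_less_one_iff)
      \<comment> \<open>For \<open>n > 0\<close> the weights differ, and then the envelope for
        \<open>Q\<close> strictly exceeds \<open>4 * N^2 * q^2\<close>, the envelope for
        \<open>G\<close>.\<close>
      then have "n = 0"
        using envelope_two_outcome_fisher_half(2)[of "a n" "b n" q N] w[of n] q eq \<open>0 < N\<close>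
        by (cases "n = 0") (auto simp: FcQ[OF set] FcG[OF set])
      then show ?thesis by simp
    qed
    assume "(2::nat) ^ (n + 1) = 2"
    then have "n = 0" by simp
    \<comment> \<open>Hence for \<open>d = 2\<close> the quantum Fisher information equals the
      envelope for \<open>G\<close>, and the chain of inequalities collapses.\<close>
    then have "2 * a n + q = 1" by (simp add: a_def field_simps)
    then have "Fq_Q n r \<phi> N \<theta> = envelope (Fc_G n r \<psi>0 \<psi>1 N)" by (simp add: FqQ[OF set] FcG[OF set])
    then show "envelope (Fc_G n r \<psi>0 \<psi>1 N) = envelope (Fc_Q n r \<phi> N)"
      and "envelope (Fc_Q n r \<phi> N) = Fq_Q n r \<phi> N \<theta>"
      using mono[OF set] upper[OF set, of \<theta>] by auto
  }
  fix A \<psi>0 \<psi>1 \<phi> \<theta>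
  assume set: "\<forall>n. amplitude_setup n (A n) (\<psi>0 n) (\<psi>1 n) (\<phi> n)"
  define c where "c n = 1 / real (n + 2)" for n :: nat
  \<comment> \<open>This value lies below the envelope for \<open>Q\<close> and has the same limit
    \<open>4 * N^2 * q\<close> as the quantum Fisher information, so the difference is squeezed to
    0.\<close>
  let ?lower = "\<lambda>n. 4 * (real N)\<^sup>2 * (q\<^sup>2 * c n * (1 - c n) / ((a n + q * c n) * (b n + q * (1 - c n))))"
  have "?lower \<longlonglongrightarrow> 4 * (real N)\<^sup>2 * q"
    unfolding a_def b_def c_def by (intro tendsto_mult tendsto_const lower_bound_limit q)
  moreover have "(\<lambda>n. Fq_Q n r (\<phi> n) N \<theta>) \<longlonglongrightarrow> 4 * (real N)\<^sup>2 * q"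
  proof -
    have "(\<lambda>n. (1 - q) * (1 / 2 ^ (n + 1))) \<longlonglongrightarrow> (1 - q) * 0"
      by (intro tendsto_mult tendsto_const) real_asymp
    then have "a \<longlonglongrightarrow> 0" unfolding a_def by simp
    then have "(\<lambda>n. 4 * (real N)\<^sup>2 * q\<^sup>2 / (2 * a n + q)) \<longlonglongrightarrow> 4 * (real N)\<^sup>2 * q\<^sup>2 / (2 * 0 + q)"
      using q by (intro tendsto_intros) auto
    moreover have "4 * (real N)\<^sup>2 * q\<^sup>2 / (2 * 0 + q) = 4 * (real N)\<^sup>2 * q"
      using q by (simp add: power2_eq_square)
    ultimately show ?thesis by (simp add: FqQ[OF set[rule_format]])
  qed
  ultimately have "(\<lambda>n. ?lower n - Fq_Q n r (\<phi> n) N \<theta>) \<longlonglongrightarrow> 4 * (real N)\<^sup>2 * q - 4 * (real N)\<^sup>2 * q"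
    by (rule tendsto_diff)
  then have lim: "(\<lambda>n. ?lower n - Fq_Q n r (\<phi> n) N \<theta>) \<longlonglongrightarrow> 0" by simp
  have lower: "?lower n \<le> envelope (Fc_Q n r (\<phi> n) N)" for n
    using envelope_two_outcome_fisher_lower[of "a n" "b n" q "c n" N] w[of n] q
    by (simp add: FcQ[OF set[rule_format]] c_def)
  show "(\<lambda>n. envelope (Fc_Q n r (\<phi> n) N) - Fq_Q n r (\<phi> n) N \<theta>) \<longlonglongrightarrow> 0"
  proof (rule tendsto_sandwich[OF _ _ lim tendsto_const])
    show "\<forall>\<^sub>F n in sequentially.
        ?lower n - Fq_Q n r (\<phi> n) N \<theta> \<le> envelope (Fc_Q n r (\<phi> n) N) - Fq_Q n r (\<phi> n) N \<theta>"
      by (intro always_eventually allI diff_right_mono lower)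
    show "\<forall>\<^sub>F n in sequentially. envelope (Fc_Q n r (\<phi> n) N) - Fq_Q n r (\<phi> n) N \<theta> \<le> 0"
      using upper[OF set[rule_format]] by (intro always_eventually allI) simp
  qed
qed

end
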